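(* Let $G=(V,E)$ be a finite simple graph with $V=\{1,\dots,n\}$, $n\ge 1$, and let $c\in\mathbb{R}$. Let $\mathbf{x}\in\Delta_n$ be a characteristic vector (i.e. $\mathbf{x}=\mathbf{x}^S$ for some non-empty $S\subseteq V$). Then $\mathbf{x}\in \mathrm{gKKT}(c)$ if and only if the induced subgraph $G[\operatorname{supp}(\mathbf{x})]$ is regular.
   Context: Graphs are finite, undirected, unweighted, without loops. $A$ is the adjacency matrix of $G$, $I$ the $n\times n$ identity matrix, $\mathbf 1$ the all-ones vector. $\Delta_n=\{\mathbf{x}\in\mathbb{R}^n:\mathbf{1}^\top\mathbf{x}=1,\ \mathbf{x}\ge\mathbf 0\}$ and $\operatorname{supp}(\mathbf{x})=\{i:x_i\ne0\}$. For non-empty $S\subseteq V$, the characteristic vector $\mathbf{x}^S\in\Delta_n$ has $x^S_i=|S|^{-1}$ if $i\in S$ and $0$ otherwise. $\mathrm{gKKT}(c)$ is the set of generalized KKT points of the program $\max_{\mathbf{x}\in\Delta_n}\mathbf{x}^\top(A+cI)\mathbf{x}$: the set of $\mathbf{x}\in\Delta_n$ for which there exist $\mu_0\in\mathbb{R}$ and $\boldsymbol\mu\in\mathbb{R}^n$ with $2(A+cI)\mathbf{x}+\mu_0\mathbf{1}+\boldsymbol\mu=\mathbf 0$ and $\mu_ix_i=0$ for every $i\in V$ (no sign condition on $\boldsymbol\mu$). A graph is regular if all its nodes have the same degree. *)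

theory Defs
  imports "HOL-Analysis.Analysis" "Graph_Theory.Graph_Theory"
begin

text \<open>
  A finite simple graph is a \<open>pair_graph\<close>: a finite, loop-free, symmetric set of ordered
  pairs, where the edge \<open>{i, j}\<close> is represented by the two arcs \<open>(i, j)\<close> and \<open>(j, i)\<close>.
  The index type \<open>'n\<close> plays the role of \<open>{1, \<dots>, n}\<close>.
\<close>

definition adjacency_matrix :: "'n::finite pair_pre_digraph \<Rightarrow> real ^ 'n ^ 'n" where
  "adjacency_matrix G = (\<chi> i j. if (i, j) \<in> parcs G then 1 else 0)"

text \<open>
  On \<open>real ^ 'n\<close> the constant \<open>1\<close> is the all-ones vector and \<open>\<le>\<close> is componentwise.
\<close>

definition std_simplex :: "(real ^ 'n::finite) set" where
  "std_simplex = {x. 1 \<bullet> x = 1 \<and> 0 \<le> x}"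

definition supp :: "real ^ 'n::finite \<Rightarrow> 'n set" where
  "supp x = {i. x $ i \<noteq> 0}"

definition char_vector :: "'n::finite set \<Rightarrow> real ^ 'n" where
  "char_vector S = (\<chi> i. if i \<in> S then 1 / real (card S) else 0)"

text \<open>There is no sign condition on \<open>\<mu>\<close>, in contrast to ordinary KKT points.\<close>

definition gKKT :: "'n::finite pair_pre_digraph \<Rightarrow> real \<Rightarrow> (real ^ 'n) set" where
  "gKKT G c = {x \<in> std_simplex. \<exists>(\<mu>\<^sub>0::real) (\<mu>::real ^ 'n).
     2 *\<^sub>R ((adjacency_matrix G + c *\<^sub>R mat 1) *v x) + \<mu>\<^sub>0 *\<^sub>R 1 + \<mu> = 0 \<and>
     (\<forall>i. \<mu> $ i * x $ i = 0)}"

text \<open>In a symmetric digraph without parallel arcs the out-degree is the undirected degree.\<close>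

definition regular_graph :: "('a, 'b) pre_digraph \<Rightarrow> bool" where
  "regular_graph H \<longleftrightarrow> (\<exists>d. \<forall>v \<in> verts H. out_degree H v = d)"

end

theory Submission
  imports Defs
begin

text \<open>
  Leaving the sign of \<open>\<mu>\<close> free, the multipliers merely absorb \<open>(A + c I) x\<close> off the support, so a
  generalized KKT point is a point at which \<open>(A + c I) x\<close> is constant on the support. For
  \<open>x = char_vector S\<close> that vector has the entry \<open>(deg i + c) / card S\<close> at \<open>i \<in> S\<close>, with the degree
  taken in the subgraph induced by \<open>S\<close>.
\<close>

lemma gKKT_iff_constant_on_supp:
  "x \<in> gKKT G c \<longleftrightarrow> x \<in> std_simplex \<and>
     (\<exists>k. \<forall>i \<in> supp x. ((adjacency_matrix G + c *\<^sub>R mat 1) *v x) $ i = k)"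
    (is "_ \<longleftrightarrow> _ \<and> (\<exists>k. \<forall>i \<in> _. ?y $ i = k)")
proof (intro iffI conjI)
  assume x: "x \<in> gKKT G c"
  then show "x \<in> std_simplex" by (simp add: gKKT_def)
  obtain \<mu>\<^sub>0 \<mu> where eq: "2 *\<^sub>R ?y + \<mu>\<^sub>0 *\<^sub>R 1 + \<mu> = 0" and compl: "\<And>i. \<mu> $ i * x $ i = 0"
    using x by (auto simp: gKKT_def)
  \<comment> \<open>On the support complementarity forces \<open>\<mu> $ i = 0\<close>, so
    coordinate \<open>i\<close> of the stationarity equation determines
    \<open>?y $ i\<close>.\<close>
  have "?y $ i = - \<mu>\<^sub>0 / 2" if "i \<in> supp x" for i
  proof -
    have "2 * ?y $ i + \<mu>\<^sub>0 + \<mu> $ i = 0"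
      using arg_cong[OF eq, of "\<lambda>v. v $ i"] by simp
    moreover have "\<mu> $ i = 0" using compl[of i] that by (simp add: supp_def)
    ultimately show ?thesis by simp
  qed
  then show "\<exists>k. \<forall>i \<in> supp x. ?y $ i = k" by blast
next
  assume "x \<in> std_simplex \<and> (\<exists>k. \<forall>i \<in> supp x. ?y $ i = k)"
  then obtain k where x: "x \<in> std_simplex" and k: "\<And>i. i \<in> supp x \<Longrightarrow> ?y $ i = k" by blast
  \<comment> \<open>With \<open>- 2 * k\<close> as the scalar multiplier, stationarity leaves only
    this choice; it vanishes wherever \<open>?y\<close> equals \<open>k\<close>, hence on the
    support.\<close>
  let ?\<mu> = "(2 * k) *\<^sub>R 1 - 2 *\<^sub>R ?y"
  have "2 *\<^sub>R ?y + (- 2 * k) *\<^sub>R 1 + ?\<mu> = 0" by simp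
  moreover have "\<forall>i. ?\<mu> $ i * x $ i = 0" using k by (auto simp: supp_def)
  ultimately show "x \<in> gKKT G c" using x unfolding gKKT_def by blast
qed

lemma supp_char_vector: "supp (char_vector S) = S"
  by (auto simp: supp_def char_vector_def)

text \<open>Each neighbour of \<open>i\<close> inside \<open>S\<close> contributes
  \<open>1 / card S\<close> to the row sum.\<close>

lemma adjacency_matrix_mult_char_vector:
  "(adjacency_matrix G *v char_vector S) $ i = card {j \<in> S. (i, j) \<in> parcs G} / card S"
proof -
  have "(adjacency_matrix G *v char_vector S) $ i =
      (\<Sum>j\<in>UNIV. if j \<in> {j \<in> S. (i, j) \<in> parcs G} then 1 / real (card S) else 0)"
    by (auto simp: matrix_vector_mult_def adjacency_matrix_def char_vector_def intro!: sum.cong)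
  also have "\<dots> = (\<Sum>j \<in> {j \<in> S. (i, j) \<in> parcs G}. 1 / real (card S))"
    by (subst sum.inter_restrict[symmetric]) simp_all
  finally show ?thesis by simp
qed

text \<open>Arcs leaving \<open>i\<close> in the induced subgraph correspond to their heads via the
  injection \<open>Pair i\<close>. For \<open>i\<close> outside \<open>S\<close> no arc survives,
  although \<open>i\<close> may have neighbours in \<open>S\<close>.\<close>

lemma out_degree_induce_subgraph_with_proj:
  assumes "i \<in> S"
  shows "out_degree (with_proj G \<restriction> S) i = card {j \<in> S. (i, j) \<in> parcs G}"
proof -
  have "out_arcs (with_proj G \<restriction> S) i = Pair i ` {j \<in> S. (i, j) \<in> parcs G}"
    using assms by (auto simp: out_arcs_def)
  then show ?thesis by (simp add: out_degree_def card_image inj_on_def)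
qed

theorem proposition4:
  fixes G :: "'n::finite pair_pre_digraph" and c :: real and x :: "real ^ 'n"
  assumes "pair_graph G" and "pverts G = UNIV"
    and "x \<in> std_simplex"
    and "\<exists>S. S \<noteq> {} \<and> S \<subseteq> pverts G \<and> x = char_vector S"
  shows "x \<in> gKKT G c \<longleftrightarrow> regular_graph (with_proj G \<restriction> supp x)"
proof -
  obtain S where "S \<noteq> {}" and x: "x = char_vector S" using assms(4) by blast
  let ?deg = "out_degree (with_proj G \<restriction> S)"
  have entry: "((adjacency_matrix G + c *\<^sub>R mat 1) *v x) $ i = (?deg i + c) / card S"
    if "i \<in> S" for i
  proof -
    have "(adjacency_matrix G + c *\<^sub>R mat 1) *v x = adjacency_matrix G *v x + c *\<^sub>R x"
      by (simp add: matrix_vector_mult_add_rdistrib scaleR_matrix_vector_assoc[symmetric])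
    moreover have "x $ i = 1 / card S" using that by (simp add: x char_vector_def)
    ultimately show ?thesis
      using that by (simp add: x adjacency_matrix_mult_char_vector
          out_degree_induce_subgraph_with_proj add_divide_distrib)
  qed
  have "x \<in> gKKT G c \<longleftrightarrow> (\<exists>k. \<forall>i \<in> S. (?deg i + c) / card S = k)"
    using assms(3) entry by (simp add: gKKT_iff_constant_on_supp supp_char_vector x)
  also have "\<dots> \<longleftrightarrow> (\<exists>d. \<forall>i \<in> S. ?deg i = d)"
  proof
    assume "\<exists>k. \<forall>i \<in> S. (?deg i + c) / card S = k"
    then obtain k where k: "\<And>i. i \<in> S \<Longrightarrow> (?deg i + c) / card S = k" by blast
    \<comment> \<open>Solving for the degree would give the real number
      \<open>k * card S - c\<close>, while \<open>d\<close> must be natural. Comparing vertices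
      pairwise avoids this: the shift \<open>c\<close> and the nonzero \<open>card S\<close> cancel,
      and the degree of any vertex of \<open>S\<close> serves as \<open>d\<close>.\<close>
    have "?deg i = ?deg j" if "i \<in> S" "j \<in> S" for i j
    proof -
      have "(?deg i + c) / card S = (?deg j + c) / card S" using k that by simp
      then show ?thesis using \<open>S \<noteq> {}\<close> by simp
    qed
    then show "\<exists>d. \<forall>i \<in> S. ?deg i = d" using \<open>S \<noteq> {}\<close> by blast
  qed auto
  also have "\<dots> \<longleftrightarrow> regular_graph (with_proj G \<restriction> supp x)"
    by (simp add: regular_graph_def supp_char_vector x)
  finally show ?thesis .
qed

end
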